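(* Let $L$ be a link in $S^3$, let $k\ge0$, and let $(B\mathcal{C},d)$ be the Bar-Natan chain complex of $L$ (with $k$ crosscuts), with a certain ordering $c_1,\dots,c_k$ of the crosscuts of each $D^k$-surface. Let $\sigma\in S_k$ and let $(B\mathcal{C}',d')$ be the Bar-Natan chain complex of $L$ that differs from $(B\mathcal{C},d)$ only in that the ordering of the crosscuts has been permuted by $\sigma$ (the crosscut $c_i$ is relabelled $c_{\sigma(i)}$, and the signs in $d'$ are computed with the new ordering). Then there is an isomorphism of chain complexes $\psi:B\mathcal{C}\to B\mathcal{C}'$.
   Context: **Surfaces.** $S^3$ is oriented. Surfaces are compact, tamely embedded in $S^3$, possibly disconnected or non-orientable, with corners smoothed. A crosscut of a surface $F$ is a properly embedded arc $c\subset F$ with $\partial c=c\cap\partial F$. Crosscuts on a surface are pairwise disjoint; each is oriented (directed) and labelled active or inactive. **Local models.** Let $Q=[-1,1]\times[-2,2]\times[-3,3]$, let $T_-=\{(x,s\sin\frac{\pi x}{2},s\cos\frac{\pi x}{2}):|x|,|s|\le 1\}$ and $T_+=\{(x,-s\sin\frac{\pi x}{2},s\cos\frac{\pi x}{2}):|x|,|s|\le 1\}$, $c_0=\{(0,0,s):|s|\le1\}$ oriented by increasing $s$, and $S=[-1,1]^2\times\{0\}$ oriented counterclockwise as seen from large positive $z$. For each active (resp. inactive) crosscut $c$ of $F$ choose an orientation-preserving embedding $\varphi_c:Q\to S^3$, with disjoint images for distinct crosscuts, such that $\varphi_c^{-1}(F)=T_-$ (resp. $T_+$) and $\varphi_c(c_0)=c$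 as oriented arcs. The cross-dual $F^{\mathrm{cd}}$ is obtained by replacing each $\varphi_c(T_\mp)$ by the locally oriented piece $F^{\mathrm{cd}}|_c:=\varphi_c(S)$. The skeleton is $\mathrm{skel}(F^{\mathrm{cd}})=\partial F^{\mathrm{cd}}\cup\bigcup_c F^{\mathrm{cd}}|_c$. The facets of $F$ are the components of $F$ minus small open neighbourhoods of the crosscuts. **$D^k$-surface.** A compact surface $F$ with $k$ oriented, ordered crosscuts $c_1,\dots,c_k$ (each active or inactive), whose facets may carry dots (which may not move between facets), such that $F^{\mathrm{cd}}$ is orientable (independently of the local orientations) and there are embedded closed 3-balls $B^3_+,B^3_-$ with $S^3=B^3_+\cup B^3_-$ and $\Sigma=B^3_+\cap B^3_-$ a 2-sphere, oriented so that positive means counterclockwise as seen from $B^3_-$, with: $\mathrm{skel}(F^{\mathrm{cd}})\subseteq\Sigma$; all local orientations of the pieces $F^{\mathrm{cd}}|_c$ agree with that of $\Sigma$; $F^{\mathrm{cd}}-\mathrm{skel}(F^{\mathrm{cd}})\subseteq B^3_+$. $D^k$-surfaces are taken up to ambient isotopy (carrying all decorations), and links up to isotopy. **Gradings.** $\mathrm{sig}(F)$ is the signature of the Goeritz matrix $(\mathrm{lk}(a_i,\tau a_j))$, where $(a_i)$ is a basis of $H_1(F;\mathbb{Q})$ and $\tau a_j$ is the pushoff of $2a_j$ (to both sides) into $S^3-F$. With $\delta(F)$ the number of dots: $I=\mathrm{sig}(F)$ (homological grading), $J=-\chi(F)-\mathrm{sig}(F)+2\delta(F)$, $K=k$, $B=\mathrm{sig}(F)+\#\{\text{active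 crosscuts}\}$. $\mathcal{C}_{i,j,k,b}(L)$ is the free $\mathbb{Z}$-module on $D^k$-surfaces with $\partial F=L$ and $(I,J,K,B)=(i,j,k,b)$. **Differential.** Let $a(y)=\frac2\pi\arcsin y$, $V=\{(s\,a(y),y,s\sqrt{1-y^2}):|y|,|s|\le 1\}$, and let $P$ be the boundary of $[-1,1]^2\times[-2,0]$ minus its open top face $(-1,1)^2\times\{0\}$. For an active crosscut $c$, $d_c(F)$ is obtained by replacing $\varphi_c(T_-)$ by $\varphi_c(P\cup V)$; the crosscut becomes the same oriented arc $\varphi_c(c_0)\subset\varphi_c(V)$, with the same place in the ordering, now labelled inactive. Put $d(F)=\sum_{c\text{ active}}(-1)^{\alpha(c)}d_c(F)$, where $\alpha(c)$ is the number of inactive crosscuts preceding $c$ in the ordering. **Bar-Natan complex.** $B\mathcal{C}_{i,j,k,b}(L)$ is the quotient of $\mathcal{C}_{i,j,k,b}(L)$ by the submodule generated by: (S0) any surface with an undotted 2-sphere component is $0$; (S1) a once-dotted 2-sphere component may be deleted; (NC) if a simple closed curve $\gamma\subset F$ misses the crosscuts and bounds a disc $D\subset S^3$ with $D\cap F=\gamma$, then $F=\bar F_\bullet+\bar F^\bullet$, where $\bar F$ is $F$ compressed along $D$ and the dot is put on one, resp. the other, of the two new parallel discs; (D2) a surface having a facet with at least two dots is $0$. $d$ induces a differential on $B\mathcal{C}$, of degree $+1$ in $i$ and preserving $j,k,b$. *)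

theory Defs
  imports "HOL-Analysis.Analysis" "HOL-Homology.Homology" "HOL-Combinatorics.Permutations" "Jordan_Normal_Form.Char_Poly"
begin

section \<open>The oriented 3-sphere\<close>

type_synonym R3 = "real \<times> real \<times> real"
type_synonym R4 = "real ^ 4"

definition S3 :: "R4 set" where
  "S3 = sphere 0 1"

definition pole :: R4 where
  "pole = axis 4 1"

text \<open>Stereographic projection from \<open>pole\<close>. It fixes the orientation of \<open>S3\<close>: it is declared to
  be orientation preserving onto the right-handed three-space. Below it is always precomposed with
  a rotation that moves the point at infinity out of the way.\<close>

definition stereo :: "R4 \<Rightarrow> R3" where
  "stereo x = (vec_nth x 1 / (1 - vec_nth x 4), vec_nth x 2 / (1 - vec_nth x 4),
               vec_nth x 3 / (1 - vec_nth x 4))"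

text \<open>Embeddings into \<open>S3\<close> are tame in the sense that they extend to an embedding of an open
  neighbourhood. The map is a total function whose values far from \<open>K\<close> are irrelevant.\<close>

definition tame_embedding :: "R3 set \<Rightarrow> (R3 \<Rightarrow> R4) \<Rightarrow> bool" where
  "tame_embedding K f \<longleftrightarrow>
     (\<exists>U. open U \<and> K \<subseteq> U \<and> continuous_on U f \<and> inj_on f U \<and> f ` U \<subseteq> S3)"

definition ambient_isotopy :: "(real \<times> R4 \<Rightarrow> R4) \<Rightarrow> bool" where
  "ambient_isotopy H \<longleftrightarrow>
     continuous_on ({0..1} \<times> S3) H \<and>
     (\<forall>t\<in>{0..1}. \<exists>g. homeomorphism S3 S3 (\<lambda>x. H (t, x)) g) \<and>
     (\<forall>x\<in>S3. H (0, x) = x)"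


section \<open>Tame surfaces and links\<close>

definition tame_surface :: "R4 set \<Rightarrow> bool" where
  "tame_surface F \<longleftrightarrow> F \<subseteq> S3 \<and> compact F \<and>
     (\<forall>x\<in>F. \<exists>U f g. openin (top_of_set S3) U \<and> x \<in> U \<and> homeomorphism U (UNIV :: R3 set) f g \<and>
        (f ` (U \<inter> F) = {(u, v, w). w = 0} \<or> f ` (U \<inter> F) = {(u, v, w). w = 0 \<and> 0 \<le> v}))"

definition surface_boundary :: "R4 set \<Rightarrow> R4 set" where
  "surface_boundary F =
     {x \<in> F. \<not> (\<exists>W. openin (top_of_set F) W \<and> x \<in> W \<and> W homeomorphic (UNIV :: (real \<times> real) set))}"

definition link :: "R4 set \<Rightarrow> bool" where
  "link L \<longleftrightarrow> L \<subseteq> S3 \<and> finite (components L) \<and>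
     (\<forall>C\<in>components L. C homeomorphic sphere (0 :: real \<times> real) 1) \<and>
     (\<forall>x\<in>L. \<exists>U f g. openin (top_of_set S3) U \<and> x \<in> U \<and> homeomorphism U (UNIV :: R3 set) f g \<and>
        f ` (U \<inter> L) = {(u, v, w). v = 0 \<and> w = 0})"

text \<open>Orientability of a compact surface: a locally consistent choice of generators of the local
  homology groups \<open>H\<^sub>2(F, F - x)\<close> at the interior points.\<close>

definition orientable :: "R4 set \<Rightarrow> bool" where
  "orientable F \<longleftrightarrow> (\<exists>\<mu>. \<forall>x \<in> F - surface_boundary F.
     \<mu> x \<in> carrier (relative_homology_group 2 (top_of_set F) (F - {x})) \<and>
     generate (relative_homology_group 2 (top_of_set F) (F - {x})) {\<mu> x}
       = carrier (relative_homology_group 2 (top_of_set F) (F - {x})) \<and>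
     (\<exists>W m. openin (top_of_set F) W \<and> x \<in> W \<and> W \<subseteq> F - surface_boundary F \<and>
        m \<in> carrier (relative_homology_group 2 (top_of_set F) (F - W)) \<and>
        (\<forall>y\<in>W. hom_induced 2 (top_of_set F) (F - W) (top_of_set F) (F - {y}) id m = \<mu> y)))"


section \<open>Rational homology and Euler characteristic\<close>

text \<open>Integral cycles \<open>as\<close> whose classes form a basis of
  \<open>H\<^sub>p(X; \<rat>) = H\<^sub>p(X; \<int>) \<otimes> \<rat>\<close>: they are independent over \<open>\<int>\<close>, and some nonzero
  multiple of every integral class is an integral combination of them.\<close>

definition rational_basis :: "nat \<Rightarrow> R4 set \<Rightarrow> R4 chain list \<Rightarrow> bool" where
  "rational_basis p X as \<longleftrightarrow>
     (\<forall>a\<in>set as. singular_relcycle p (top_of_set X) {} a) \<and>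
     (\<forall>n. singular_relboundary p (top_of_set X) {} (\<Sum>i<length as. frag_cmul (n i) (as ! i))
        \<longrightarrow> (\<forall>i<length as. n i = 0)) \<and>
     (\<forall>c. singular_relcycle p (top_of_set X) {} c \<longrightarrow>
        (\<exists>m n. m \<noteq> 0 \<and> homologous_rel p (top_of_set X) {} (frag_cmul m c)
                              (\<Sum>i<length as. frag_cmul (n i) (as ! i))))"

definition betti :: "nat \<Rightarrow> R4 set \<Rightarrow> nat" where
  "betti p X = (THE n. \<exists>as. rational_basis p X as \<and> length as = n)"

text \<open>Only used for surfaces, which have no homology above degree 2.\<close>

definition euler_char :: "R4 set \<Rightarrow> int" where
  "euler_char F = int (betti 0 F) - int (betti 1 F) + int (betti 2 F)"


section \<open>Linking numbers\<close>

definition edge :: "real \<Rightarrow> nat \<Rightarrow> real" where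
  "edge t = (\<lambda>i. if i = 0 then 1 - t else if i = 1 then t else 0)"

text \<open>For singular 1-simplices \<open>\<sigma>, \<rho>\<close> this is the singular 2-chain \<open>\<sigma> \<times> \<rho>\<close> (the square cut
  along its diagonal into two triangles), mapped to the unit 2-sphere by the Gauss map
  \<open>(s, t) \<mapsto> (\<rho> t - \<sigma> s) / |\<rho> t - \<sigma> s|\<close>. Extended bilinearly, it sends pairs of disjoint
  1-cycles to 2-cycles.\<close>

definition gauss_simplex :: "((nat \<Rightarrow> real) \<Rightarrow> R3) \<Rightarrow> ((nat \<Rightarrow> real) \<Rightarrow> R3) \<Rightarrow> R3 chain" where
  "gauss_simplex \<sigma> \<rho> =
     frag_of (\<lambda>x\<in>standard_simplex 2. sgn (\<rho> (edge (x 2)) - \<sigma> (edge (x 1 + x 2)))) -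
     frag_of (\<lambda>x\<in>standard_simplex 2. sgn (\<rho> (edge (x 1 + x 2)) - \<sigma> (edge (x 2))))"

definition gauss_chain :: "R3 chain \<Rightarrow> R3 chain \<Rightarrow> R3 chain" where
  "gauss_chain c d = frag_extend (\<lambda>\<sigma>. frag_extend (\<lambda>\<rho>. gauss_simplex \<sigma> \<rho>) d) c"

text \<open>The positive Hopf link: the second circle crosses the flat disc bounded by the first
  (counterclockwise) circle once, in the direction of the positive third axis. It pins down the
  sign of the linking number.\<close>

definition hopf1 :: "R3 chain" where
  "hopf1 = frag_of (\<lambda>x\<in>standard_simplex 1. (cos (2 * pi * x 1), sin (2 * pi * x 1), 0))"

definition hopf2 :: "R3 chain" where
  "hopf2 = frag_of (\<lambda>x\<in>standard_simplex 1. (1 - cos (2 * pi * x 1), 0, sin (2 * pi * x 1)))"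

text \<open>The degree of the Gauss map, normalised so that the positive Hopf link has linking number 1.\<close>

definition linking_number :: "R4 chain \<Rightarrow> R4 chain \<Rightarrow> int" where
  "linking_number c d = (THE n. \<exists>A :: real^4^4. rotation_matrix A \<and>
     (\<forall>\<sigma> \<in> Poly_Mapping.keys c \<union> Poly_Mapping.keys d. \<forall>x\<in>standard_simplex 1. A *v \<sigma> x \<noteq> pole) \<and>
     homologous_rel 2 (top_of_set (sphere 0 1)) {}
       (gauss_chain (chain_map 1 (\<lambda>x. stereo (A *v x)) c) (chain_map 1 (\<lambda>x. stereo (A *v x)) d))
       (frag_cmul n (gauss_chain hopf1 hopf2)))"


section \<open>The signature of the Goeritz matrix\<close>

text \<open>\<open>N\<close> is an \<open>[-1,1]\<close>-bundle over its zero section \<open>F\<close> with projection \<open>p\<close>, and \<open>Ft\<close> is the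
  double cover of \<open>F\<close> formed by the endpoints of the fibres.\<close>

definition interval_bundle :: "R4 set \<Rightarrow> R4 set \<Rightarrow> R4 set \<Rightarrow> (R4 \<Rightarrow> R4) \<Rightarrow> bool" where
  "interval_bundle F N Ft p \<longleftrightarrow>
     N \<subseteq> S3 \<and> Ft \<subseteq> N \<and> continuous_on N p \<and> p ` N \<subseteq> F \<and>
     (\<forall>x\<in>F. \<exists>W h g. openin (top_of_set F) W \<and> x \<in> W \<and>
        homeomorphism (W \<times> {-1..1 :: real}) (N \<inter> p -` W) h g \<and>
        (\<forall>w\<in>W. h (w, 0) = w \<and>
           (\<forall>t\<in>{-1..1}. p (h (w, t)) = w \<and> (h (w, t) \<in> Ft \<longleftrightarrow> \<bar>t\<bar> = 1))))"

text \<open>The pushoff \<open>\<tau>\<close> of twice a cycle to both sides: the transfer of the double cover, which sends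
  every singular simplex to the sum of its two lifts.\<close>

definition pushoff :: "R4 set \<Rightarrow> (R4 \<Rightarrow> R4) \<Rightarrow> R4 chain \<Rightarrow> R4 chain" where
  "pushoff Ft p = frag_extend (\<lambda>\<sigma>.
     \<Sum>\<sigma>' \<in> {\<sigma>'. singular_simplex 1 (top_of_set Ft) \<sigma>' \<and> simplex_map 1 p \<sigma>' = \<sigma>}. frag_of \<sigma>')"

definition goeritz_matrix :: "R4 set \<Rightarrow> real mat \<Rightarrow> bool" where
  "goeritz_matrix F M \<longleftrightarrow> (\<exists>as N Ft p. rational_basis 1 F as \<and> interval_bundle F N Ft p \<and>
     M = mat (length as) (length as)
           (\<lambda>(i, j). of_int (linking_number (as ! i) (pushoff Ft p (as ! j)))))"

text \<open>Number of positive minus number of negative eigenvalues, with multiplicity.\<close>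

definition matrix_signature :: "real mat \<Rightarrow> int" where
  "matrix_signature M =
     int (\<Sum>x \<in> {x. 0 < x \<and> poly (char_poly M) x = 0}. Polynomial.order x (char_poly M)) -
     int (\<Sum>x \<in> {x. x < 0 \<and> poly (char_poly M) x = 0}. Polynomial.order x (char_poly M))"

definition sig :: "R4 set \<Rightarrow> int" where
  "sig F = (THE s. \<exists>M. goeritz_matrix F M \<and> s = matrix_signature M)"


section \<open>Decorated surfaces\<close>

text \<open>An oriented arc is given by its point set and its initial point. The position in the list
  \<open>crosscuts\<close> is the ordering. The facets are represented by the components of the complement of
  the crosscuts, which correspond to the components of the complement of small open neighbourhoods
  of the crosscuts; only the values of \<open>dots\<close> on facets are meaningful.\<close>

record crosscut =
  arc_of :: "R4 set"
  start_of :: R4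
  active :: bool

record dsurf =
  surf :: "R4 set"
  crosscuts :: "crosscut list"
  dots :: "R4 set \<Rightarrow> nat"

definition facets :: "dsurf \<Rightarrow> R4 set set" where
  "facets F = components (surf F - (\<Union>c\<in>set (crosscuts F). arc_of c))"

definition dot_count :: "dsurf \<Rightarrow> nat" where
  "dot_count F = (\<Sum>C\<in>facets F. dots F C)"

definition is_crosscut :: "R4 set \<Rightarrow> crosscut \<Rightarrow> bool" where
  "is_crosscut F c \<longleftrightarrow> (\<exists>g. arc g \<and> path_image g = arc_of c \<and> pathstart g = start_of c \<and>
     arc_of c \<subseteq> F \<and> arc_of c \<inter> surface_boundary F = {pathstart g, pathfinish g})"

definition decorated_surface :: "dsurf \<Rightarrow> bool" where
  "decorated_surface F \<longleftrightarrow> tame_surface (surf F) \<and>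
     (\<forall>c\<in>set (crosscuts F). is_crosscut (surf F) c) \<and>
     (\<forall>i<length (crosscuts F). \<forall>j<length (crosscuts F). i \<noteq> j \<longrightarrow>
        arc_of (crosscuts F ! i) \<inter> arc_of (crosscuts F ! j) = {})"

definition isotopic :: "dsurf \<Rightarrow> dsurf \<Rightarrow> bool" where
  "isotopic F G \<longleftrightarrow> (\<exists>H. ambient_isotopy H \<and>
     (let h = (\<lambda>x. H (1, x)) in
        surf G = h ` surf F \<and>
        crosscuts G = map (\<lambda>c. \<lparr>arc_of = h ` arc_of c, start_of = h (start_of c), active = active c\<rparr>)
                          (crosscuts F) \<and>
        (\<forall>C\<in>facets F. dots G (h ` C) = dots F C)))"

definition iso_class :: "dsurf \<Rightarrow> dsurf set" where
  "iso_class F = {G. isotopic F G}"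


section \<open>Local models\<close>

definition Q :: "R3 set" where
  "Q = {-1..1} \<times> {-2..2} \<times> {-3..3}"

definition T_minus :: "R3 set" where
  "T_minus = {(x, s * sin (pi * x / 2), s * cos (pi * x / 2)) |x s. \<bar>x\<bar> \<le> 1 \<and> \<bar>s\<bar> \<le> 1}"

definition T_plus :: "R3 set" where
  "T_plus = {(x, - s * sin (pi * x / 2), s * cos (pi * x / 2)) |x s. \<bar>x\<bar> \<le> 1 \<and> \<bar>s\<bar> \<le> 1}"

definition c0 :: "R3 set" where
  "c0 = {(0, 0, s) |s. \<bar>s\<bar> \<le> 1}"

definition c0_start :: R3 where
  "c0_start = (0, 0, -1)"

definition S :: "R3 set" where
  "S = {-1..1} \<times> {-1..1} \<times> {0}"

definition V :: "R3 set" where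
  "V = {(s * (2 / pi * arcsin y), y, s * sqrt (1 - y\<^sup>2)) |s y. \<bar>y\<bar> \<le> 1 \<and> \<bar>s\<bar> \<le> 1}"

definition P :: "R3 set" where
  "P = frontier ({-1..1} \<times> {-1..1} \<times> {-2..0}) - {-1<..<1} \<times> {-1<..<1} \<times> {0}"

definition T_model :: "bool \<Rightarrow> R3 set" where
  "T_model a = (if a then T_minus else T_plus)"

text \<open>Local degree \<open>1\<close> at the origin: in coordinates centred at the image of the origin, the map
  acts on \<open>H\<^sub>3(Q, Q - 0)\<close> like the inclusion. Since \<open>Q\<close> is connected, one point suffices.\<close>

definition orientation_preserving :: "(R3 \<Rightarrow> R4) \<Rightarrow> bool" where
  "orientation_preserving \<phi> \<longleftrightarrow> (\<exists>A :: real^4^4. rotation_matrix A \<and> (\<forall>x\<in>Q. A *v \<phi> x \<noteq> pole) \<and>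
     hom_induced 3 (top_of_set Q) (Q - {0}) euclidean (- {0})
       (\<lambda>x. stereo (A *v \<phi> x) - stereo (A *v \<phi> 0)) =
     hom_induced 3 (top_of_set Q) (Q - {0}) euclidean (- {0 :: R3}) id)"

definition adapted :: "dsurf \<Rightarrow> (nat \<Rightarrow> R3 \<Rightarrow> R4) \<Rightarrow> bool" where
  "adapted F \<phi> \<longleftrightarrow>
     (\<forall>i<length (crosscuts F). let c = crosscuts F ! i in
        tame_embedding Q (\<phi> i) \<and> orientation_preserving (\<phi> i) \<and>
        {q \<in> Q. \<phi> i q \<in> surf F} = T_model (active c) \<and>
        \<phi> i ` c0 = arc_of c \<and> \<phi> i c0_start = start_of c) \<and>
     (\<forall>i<length (crosscuts F). \<forall>j<length (crosscuts F). i \<noteq> j \<longrightarrow> \<phi> i ` Q \<inter> \<phi> j ` Q = {})"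

definition cross_dual :: "dsurf \<Rightarrow> (nat \<Rightarrow> R3 \<Rightarrow> R4) \<Rightarrow> R4 set" where
  "cross_dual F \<phi> =
     (surf F - (\<Union>i<length (crosscuts F). \<phi> i ` T_model (active (crosscuts F ! i)))) \<union>
     (\<Union>i<length (crosscuts F). \<phi> i ` S)"

definition skel :: "dsurf \<Rightarrow> (nat \<Rightarrow> R3 \<Rightarrow> R4) \<Rightarrow> R4 set" where
  "skel F \<phi> = surface_boundary (cross_dual F \<phi>) \<union> (\<Union>i<length (crosscuts F). \<phi> i ` S)"

text \<open>The piece \<open>\<phi> i ` S\<close> is oriented counterclockwise as seen from the side \<open>\<phi> i ` {z > 0}\<close>
  (\<open>\<phi> i\<close> preserves orientation), and \<open>\<Sigma> = Bp \<inter> Bm\<close> counterclockwise as seen from \<open>Bm\<close>. So the two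
  orientations agree iff \<open>\<phi> i\<close> maps the side \<open>z > 0\<close> of \<open>S\<close> into \<open>Bm\<close>, which is the last
  condition.\<close>

definition Dk_surface :: "nat \<Rightarrow> dsurf \<Rightarrow> bool" where
  "Dk_surface k F \<longleftrightarrow> decorated_surface F \<and> length (crosscuts F) = k \<and>
     (\<exists>\<phi>. adapted F \<phi> \<and> orientable (cross_dual F \<phi>) \<and>
       (\<exists>Bp Bm. Bp homeomorphic cball (0 :: R3) 1 \<and> Bm homeomorphic cball (0 :: R3) 1 \<and>
          Bp \<union> Bm = S3 \<and> Bp \<inter> Bm homeomorphic sphere (0 :: R3) 1 \<and>
          skel F \<phi> \<subseteq> Bp \<inter> Bm \<and>
          cross_dual F \<phi> - skel F \<phi> \<subseteq> Bp \<and>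
          (\<forall>i<k. \<forall>x\<in>{-1<..<1}. \<forall>y\<in>{-1<..<1}. \<exists>\<epsilon>>0. \<forall>z\<in>{0<..<\<epsilon>}. \<phi> i (x, y, z) \<in> Bm)))"


section \<open>The chain modules and the differential\<close>

text \<open>Representatives of the generators in degree \<open>(I, J, K, B) = (i, j, k, b)\<close>.\<close>

definition gens :: "R4 set \<Rightarrow> nat \<Rightarrow> int \<Rightarrow> int \<Rightarrow> int \<Rightarrow> dsurf set" where
  "gens L k i j b = {F. Dk_surface k F \<and> surface_boundary (surf F) = L \<and>
     i = sig (surf F) \<and>
     j = - euler_char (surf F) - sig (surf F) + 2 * int (dot_count F) \<and>
     b = sig (surf F) + int (length (filter active (crosscuts F)))}"

definition chain_module ::
    "R4 set \<Rightarrow> nat \<Rightarrow> int \<Rightarrow> int \<Rightarrow> int \<Rightarrow> (dsurf set \<Rightarrow>\<^sub>0 int) monoid" where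
  "chain_module L k i j b = free_Abelian_group (iso_class ` gens L k i j b)"

text \<open>\<open>d\<^sub>c F\<close> for the \<open>i\<close>-th crosscut. A facet of the result collects the dots of all
  facets of \<open>F\<close> which it contains after the interior of the local model has been removed.\<close>

definition surgery :: "dsurf \<Rightarrow> (nat \<Rightarrow> R3 \<Rightarrow> R4) \<Rightarrow> nat \<Rightarrow> dsurf" where
  "surgery F \<phi> i = \<lparr>surf = (surf F - \<phi> i ` T_minus) \<union> \<phi> i ` (P \<union> V),
     crosscuts = (crosscuts F)[i := (crosscuts F ! i)\<lparr>active := False\<rparr>],
     dots = (\<lambda>C'. \<Sum>C \<in> {C \<in> facets F. C - \<phi> i ` interior Q \<subseteq> C'}. dots F C)\<rparr>"

text \<open>A permutation \<open>p\<close> of the indices encodes an ordering: the crosscut \<open>crosscuts F ! i\<close> is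
  labelled \<open>p i\<close>. The original ordering is \<open>p = id\<close>; relabelling every \<open>c\<^sub>i\<close> as
  \<open>c\<close> with index \<open>\<sigma> i\<close> gives \<open>p = \<sigma>\<close>.\<close>

definition num_before :: "(nat \<Rightarrow> nat) \<Rightarrow> dsurf \<Rightarrow> nat \<Rightarrow> nat" where
  "num_before p F i =
     card {l. l < length (crosscuts F) \<and> \<not> active (crosscuts F ! l) \<and> p l < p i}"

definition d_gen :: "(nat \<Rightarrow> nat) \<Rightarrow> dsurf set \<Rightarrow> (dsurf set \<Rightarrow>\<^sub>0 int)" where
  "d_gen p X = (case (SOME (F, \<phi>). F \<in> X \<and> adapted F \<phi>) of (F, \<phi>) \<Rightarrow>
     \<Sum>i \<in> {i. i < length (crosscuts F) \<and> active (crosscuts F ! i)}.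
       frag_cmul ((-1) ^ num_before p F i) (frag_of (iso_class (surgery F \<phi> i))))"

definition d :: "(nat \<Rightarrow> nat) \<Rightarrow> (dsurf set \<Rightarrow>\<^sub>0 int) \<Rightarrow> (dsurf set \<Rightarrow>\<^sub>0 int)" where
  "d p = frag_extend (d_gen p)"


section \<open>The Bar-Natan complex\<close>

definition sphere_component :: "dsurf \<Rightarrow> R4 set \<Rightarrow> bool" where
  "sphere_component F A \<longleftrightarrow> A \<in> components (surf F) \<and> A homeomorphic sphere (0 :: R3) 1"

definition cylinder :: "R3 set" where
  "cylinder = {(x, y, t). x\<^sup>2 + y\<^sup>2 \<le> 1 \<and> \<bar>t\<bar> \<le> 1}"

text \<open>\<open>\<beta>\<close> is a thickening of a compressing disc \<open>D = \<beta> ` {t = 0}\<close> with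
  \<open>D \<inter> F = \<gamma> = \<beta> ` {x\<^sup>2 + y\<^sup>2 = 1, t = 0}\<close>; the parallel discs are \<open>\<beta> ` {t = 1}\<close> and
  \<open>\<beta> ` {t = -1}\<close>.\<close>

definition compressing :: "dsurf \<Rightarrow> (R3 \<Rightarrow> R4) \<Rightarrow> bool" where
  "compressing F \<beta> \<longleftrightarrow> tame_embedding cylinder \<beta> \<and>
     {q \<in> cylinder. \<beta> q \<in> surf F} = {(x, y, t). x\<^sup>2 + y\<^sup>2 = 1 \<and> \<bar>t\<bar> \<le> 1} \<and>
     (\<forall>c\<in>set (crosscuts F). arc_of c \<inter> \<beta> ` cylinder = {})"

definition compress :: "dsurf \<Rightarrow> (R3 \<Rightarrow> R4) \<Rightarrow> (R4 set \<Rightarrow> nat) \<Rightarrow> dsurf" where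
  "compress F \<beta> n = F\<lparr>
     surf := (surf F - \<beta> ` {(x, y, t). x\<^sup>2 + y\<^sup>2 = 1 \<and> \<bar>t\<bar> < 1}) \<union>
             \<beta> ` {(x, y, t). x\<^sup>2 + y\<^sup>2 \<le> 1 \<and> \<bar>t\<bar> = 1},
     dots := n\<rparr>"

text \<open>The dots of \<open>F\<close> survive the compression; if a facet is cut in two, its dots may lie on
  either part.\<close>

definition compatible_dots :: "dsurf \<Rightarrow> (R3 \<Rightarrow> R4) \<Rightarrow> (R4 set \<Rightarrow> nat) \<Rightarrow> bool" where
  "compatible_dots F \<beta> n \<longleftrightarrow>
     (\<forall>C\<in>facets F. dots F C = (\<Sum>C' \<in> {C' \<in> facets (compress F \<beta> n). C' \<inter> C \<noteq> {}}. n C'))"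

definition add_dot :: "R4 \<Rightarrow> (R4 set \<Rightarrow> nat) \<Rightarrow> (R4 set \<Rightarrow> nat)" where
  "add_dot x n = (\<lambda>C. n C + (if x \<in> C then 1 else 0))"

inductive_set BN_rels :: "R4 set \<Rightarrow> nat \<Rightarrow> int \<Rightarrow> int \<Rightarrow> int \<Rightarrow> (dsurf set \<Rightarrow>\<^sub>0 int) set"
  for L k i j b
where
  S0: "F \<in> gens L k i j b \<Longrightarrow> sphere_component F A \<Longrightarrow> dots F A = 0 \<Longrightarrow>
       frag_of (iso_class F) \<in> BN_rels L k i j b"
| S1: "F \<in> gens L k i j b \<Longrightarrow> sphere_component F A \<Longrightarrow> dots F A = 1 \<Longrightarrow>
       F\<lparr>surf := surf F - A\<rparr> \<in> gens L k i j b \<Longrightarrow>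
       frag_of (iso_class F) - frag_of (iso_class (F\<lparr>surf := surf F - A\<rparr>)) \<in> BN_rels L k i j b"
| NC: "F \<in> gens L k i j b \<Longrightarrow> compressing F \<beta> \<Longrightarrow> compatible_dots F \<beta> n \<Longrightarrow>
       F1 = compress F \<beta> (add_dot (\<beta> (0, 0, -1)) n) \<Longrightarrow>
       F2 = compress F \<beta> (add_dot (\<beta> (0, 0, 1)) n) \<Longrightarrow>
       F1 \<in> gens L k i j b \<Longrightarrow> F2 \<in> gens L k i j b \<Longrightarrow>
       frag_of (iso_class F) - (frag_of (iso_class F1) + frag_of (iso_class F2)) \<in> BN_rels L k i j b"
| D2: "F \<in> gens L k i j b \<Longrightarrow> C \<in> facets F \<Longrightarrow> dots F C \<ge> 2 \<Longrightarrow>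
       frag_of (iso_class F) \<in> BN_rels L k i j b"

definition BN_sub :: "R4 set \<Rightarrow> nat \<Rightarrow> int \<Rightarrow> int \<Rightarrow> int \<Rightarrow> (dsurf set \<Rightarrow>\<^sub>0 int) set" where
  "BN_sub L k i j b = generate (chain_module L k i j b) (BN_rels L k i j b)"

definition BN :: "R4 set \<Rightarrow> nat \<Rightarrow> int \<Rightarrow> int \<Rightarrow> int \<Rightarrow> (dsurf set \<Rightarrow>\<^sub>0 int) set monoid" where
  "BN L k i j b = chain_module L k i j b Mod BN_sub L k i j b"

text \<open>The induced differential from degree \<open>(i, j, b)\<close> to degree \<open>(i + 1, j, b)\<close>, on cosets. Since
  \<open>d\<close> preserves the submodules, the cosets of \<open>d p x\<close> for \<open>x \<in> X\<close> all coincide.\<close>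

definition BN_d :: "(nat \<Rightarrow> nat) \<Rightarrow> R4 set \<Rightarrow> nat \<Rightarrow> int \<Rightarrow> int \<Rightarrow> int \<Rightarrow>
    (dsurf set \<Rightarrow>\<^sub>0 int) set \<Rightarrow> (dsurf set \<Rightarrow>\<^sub>0 int) set" where
  "BN_d p L k i j b X =
     (\<Union>x\<in>X. BN_sub L k (i + 1) j b #>\<^bsub>chain_module L k (i + 1) j b\<^esub> d p x)"

definition chain_isomorphism ::
    "(int \<Rightarrow> int \<Rightarrow> int \<Rightarrow> 'a monoid) \<Rightarrow> (int \<Rightarrow> int \<Rightarrow> int \<Rightarrow> 'a \<Rightarrow> 'a) \<Rightarrow>
     (int \<Rightarrow> int \<Rightarrow> int \<Rightarrow> 'b monoid) \<Rightarrow> (int \<Rightarrow> int \<Rightarrow> int \<Rightarrow> 'b \<Rightarrow> 'b) \<Rightarrow>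
     (int \<Rightarrow> int \<Rightarrow> int \<Rightarrow> 'a \<Rightarrow> 'b) \<Rightarrow> bool" where
  "chain_isomorphism A dA B dB \<psi> \<longleftrightarrow>
     (\<forall>i j b. \<psi> i j b \<in> iso (A i j b) (B i j b)) \<and>
     (\<forall>i j b. \<forall>x\<in>carrier (A i j b). \<psi> (i + 1) j b (dA i j b x) = dB i j b (\<psi> i j b x))"

end

theory Submission
  imports Defs
begin

text \<open>Multiply every generator by the sign of the permutation which \<open>\<sigma>\<close> induces on its inactive
  crosscuts. This sign is an isotopy invariant, and all terms of a Bar-Natan relation carry the
  same crosscuts, hence the same sign. Inactivating the crosscut \<open>i\<close> changes the sign by the parity
  of the number of inactive crosscuts whose order relative to \<open>i\<close> is reversed by \<open>\<sigma>\<close>, which is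
  precisely the quotient of the signs with which \<open>d\<^sub>i\<close> enters the two differentials.\<close>

section \<open>Signs of a permutation on sets of indices\<close>

definition inactive :: "dsurf \<Rightarrow> nat set" where
  "inactive F = {l. l < length (crosscuts F) \<and> \<not> active (crosscuts F ! l)}"

definition inversions_on :: "(nat \<Rightarrow> nat) \<Rightarrow> nat set \<Rightarrow> (nat \<times> nat) set" where
  "inversions_on \<sigma> A = {(l, m). l \<in> A \<and> m \<in> A \<and> l < m \<and> \<sigma> m < \<sigma> l}"

text \<open>\<open>\<sigma>\<close> need not preserve \<open>A\<close>. For injective
  \<open>\<sigma>\<close> and finite \<open>A\<close> this is the sign of the permutation obtained
  by numbering \<open>A\<close> and its image in increasing order.\<close>

definition sign_on :: "(nat \<Rightarrow> nat) \<Rightarrow> nat set \<Rightarrow> int" where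
  "sign_on \<sigma> A = (-1) ^ card (inversions_on \<sigma> A)"

text \<open>The factor is a sign for every \<open>X\<close>, whatever is chosen, so the map is an
  involution of the whole free module; on isotopy classes the choice is immaterial.\<close>

definition reorder :: "(nat \<Rightarrow> nat) \<Rightarrow> (dsurf set \<Rightarrow>\<^sub>0 int) \<Rightarrow> (dsurf set \<Rightarrow>\<^sub>0 int)" where
  "reorder \<sigma> =
     frag_extend (\<lambda>X. frag_cmul (sign_on \<sigma> (inactive (SOME F. F \<in> X))) (frag_of X))"

lemma frag_cmul_diff: "frag_cmul n (x - y) = frag_cmul n x - frag_cmul n y"
  by (simp add: poly_mapping_eq_iff fun_eq_iff lookup_minus right_diff_distrib)

lemma finite_inactive [simp]: "finite (inactive F)"
  by (simp add: inactive_def)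

lemma sign_on_square [simp]: "sign_on \<sigma> A * sign_on \<sigma> A = 1"
  by (simp add: sign_on_def flip: power_mult_distrib)

text \<open>The new inversions pair \<open>i\<close> with the elements whose order relative to
  \<open>i\<close> is reversed. Their number has the parity of the sum of the two counts, which are
  the sign exponents of the two differentials.\<close>

lemma sign_on_insert:
  assumes "inj \<sigma>" "finite A" "i \<notin> A"
  shows "sign_on \<sigma> (insert i A) =
    sign_on \<sigma> A * (-1) ^ card {l \<in> A. l < i} * (-1) ^ card {l \<in> A. \<sigma> l < \<sigma> i}"
proof -
  \<comment> \<open>\<open>R1\<close> and \<open>R2\<close> give the new inversions;
    \<open>R3\<close> holds the elements below \<open>i\<close> in both orders.\<close>
  define R1 where "R1 = {l \<in> A. l < i \<and> \<sigma> i < \<sigma> l}"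
  define R2 where "R2 = {l \<in> A. i < l \<and> \<sigma> l < \<sigma> i}"
  define R3 where "R3 = {l \<in> A. l < i \<and> \<sigma> l < \<sigma> i}"
  have fin: "finite R1" "finite R2" "finite R3"
    using assms(2) by (auto simp: R1_def R2_def R3_def)
  have "inversions_on \<sigma> A \<subseteq> A \<times> A"
    by (auto simp: inversions_on_def)
  then have finI: "finite (inversions_on \<sigma> A)"
    using assms(2) finite_subset by blast
  have "inversions_on \<sigma> (insert i A) = inversions_on \<sigma> A \<union> ((\<lambda>l. (l, i)) ` R1 \<union> Pair i ` R2)"
    by (auto simp: inversions_on_def R1_def R2_def)
  also have "card \<dots> = card (inversions_on \<sigma> A) + card ((\<lambda>l. (l, i)) ` R1 \<union> Pair i ` R2)"
    using fin finI assms(3)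
    by (intro card_Un_disjoint) (auto simp: inversions_on_def)
  also have "card ((\<lambda>l. (l, i)) ` R1 \<union> Pair i ` R2) = card ((\<lambda>l. (l, i)) ` R1) + card (Pair i ` R2)"
    using fin by (intro card_Un_disjoint) (auto simp: R1_def)
  also have "\<dots> = card R1 + card R2"
    by (simp add: card_image inj_on_def)
  finally have inv: "card (inversions_on \<sigma> (insert i A)) =
      card (inversions_on \<sigma> A) + (card R1 + card R2)" .
  have ne: "\<sigma> l \<noteq> \<sigma> i" "l \<noteq> i" if "l \<in> A" for l
    using that assms by (auto dest: injD)
  have "{l \<in> A. l < i} = R1 \<union> R3" "{l \<in> A. \<sigma> l < \<sigma> i} = R2 \<union> R3"
    using ne by (auto simp: R1_def R2_def R3_def neq_iff)
  moreover have "R1 \<inter> R3 = {}" "R2 \<inter> R3 = {}"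
    by (auto simp: R1_def R2_def R3_def)
  ultimately have c: "card {l \<in> A. l < i} = card R1 + card R3"
       "card {l \<in> A. \<sigma> l < \<sigma> i} = card R2 + card R3"
    using fin by (simp_all only: card_Un_disjoint)
  \<comment> \<open>Both counts contain \<open>R3\<close>, so its contribution cancels modulo
    2.\<close>
  have "(-1 :: int) ^ card R3 * (-1) ^ card R3 = 1"
    by (simp flip: power_mult_distrib)
  then show ?thesis
    by (simp add: sign_on_def inv c power_add mult.assoc mult.left_commute)
qed

section \<open>The sign twist on isotopy classes and chains\<close>

lemma isotopic_refl: "isotopic F F"
proof -
  have "ambient_isotopy snd"
    unfolding ambient_isotopy_def
    by (auto intro: continuous_on_snd continuous_on_id homeomorphism_ident)
  then show ?thesis
    unfolding isotopic_def by (intro exI[of _ snd]) (auto simp: Let_def list_eq_iff_nth_eq)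
qed

lemma mem_iso_class_self [simp]: "F \<in> iso_class F"
  by (simp add: iso_class_def isotopic_refl)

text \<open>An isotopy transports the crosscut list entry by entry and keeps the labels.\<close>

lemma inactive_iso_class: "G \<in> iso_class F \<Longrightarrow> inactive G = inactive F"
  by (auto simp: iso_class_def isotopic_def inactive_def Let_def)

lemma reorder_iso_class:
  "reorder \<sigma> (frag_of (iso_class F)) =
     frag_cmul (sign_on \<sigma> (inactive F)) (frag_of (iso_class F))"
proof -
  have "(SOME G. G \<in> iso_class F) \<in> iso_class F"
    by (rule someI) (rule mem_iso_class_self)
  then show ?thesis
    by (simp add: reorder_def inactive_iso_class)
qed

lemma reorder_add: "reorder \<sigma> (x + y) = reorder \<sigma> x + reorder \<sigma> y"
  by (simp add: reorder_def frag_extend_add)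

lemma reorder_minus: "reorder \<sigma> (- x) = - reorder \<sigma> x"
  by (simp add: reorder_def frag_extend_minus)

lemma reorder_cmul: "reorder \<sigma> (frag_cmul n x) = frag_cmul n (reorder \<sigma> x)"
  by (simp add: reorder_def frag_extend_cmul)

lemma reorder_reorder [simp]: "reorder \<sigma> (reorder \<sigma> x) = x"
proof -
  have "Poly_Mapping.keys x \<subseteq> UNIV" by simp
  then show ?thesis
  proof (induction x rule: frag_induction)
    case zero
    then show ?case by (simp add: reorder_def)
  next
    case (one X)
    then show ?case
      by (simp add: reorder_def frag_extend_cmul)
  next
    case (diff a b)
    then show ?case by (simp add: reorder_def frag_extend_diff)
  qed
qed

lemma keys_reorder: "Poly_Mapping.keys (reorder \<sigma> x) \<subseteq> Poly_Mapping.keys x"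
proof -
  have "Poly_Mapping.keys (reorder \<sigma> x) \<subseteq> (\<Union>X\<in>Poly_Mapping.keys x.
     Poly_Mapping.keys (frag_cmul (sign_on \<sigma> (inactive (SOME F. F \<in> X))) (frag_of X)))"
    unfolding reorder_def by (rule keys_frag_extend)
  also have "\<dots> \<subseteq> Poly_Mapping.keys x"
    using keys_cmul by fastforce
  finally show ?thesis .
qed

section \<open>Compatibility with the differentials\<close>

text \<open>The choice inside \<open>d_gen\<close> does not mention \<open>p\<close>, so one pair
  \<open>(G, \<psi>)\<close> serves both orderings and the differentials can be compared term by
  term.\<close>

lemma d_gen_representative:
  assumes "F \<in> X" "adapted F \<phi>"
  obtains G \<psi> where "G \<in> X" "adapted G \<psi>"
    "\<And>p. d_gen p X = (\<Sum>i \<in> {i. i < length (crosscuts G) \<and> active (crosscuts G ! i)}.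
       frag_cmul ((-1) ^ num_before p G i) (frag_of (iso_class (surgery G \<psi> i))))"
proof -
  obtain G \<psi> where eq: "(SOME (F, \<phi>). F \<in> X \<and> adapted F \<phi>) = (G, \<psi>)"
    by fastforce
  have "case (SOME (F, \<phi>). F \<in> X \<and> adapted F \<phi>) of (F, \<phi>) \<Rightarrow> F \<in> X \<and> adapted F \<phi>"
    by (rule someI[of _ "(F, \<phi>)"]) (use assms in simp)
  then show thesis
    using that[of G \<psi>] by (simp add: eq d_gen_def)
qed

lemma inactive_surgery:
  "i < length (crosscuts F) \<Longrightarrow> inactive (surgery F \<phi> i) = insert i (inactive F)"
  by (auto simp: inactive_def surgery_def nth_list_update)

lemma num_before_eq: "num_before p F i = card {l \<in> inactive F. p l < p i}"
  by (simp add: num_before_def inactive_def)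

lemma reorder_d_gen:
  assumes "inj \<sigma>" "F \<in> gens L k i j b"
  shows "reorder \<sigma> (d_gen id (iso_class F)) = d \<sigma> (reorder \<sigma> (frag_of (iso_class F)))"
proof -
  obtain \<phi> where \<phi>: "adapted F \<phi>"
    using assms(2) unfolding gens_def Dk_surface_def by blast
  obtain G \<psi> where G: "G \<in> iso_class F" and dG:
    "\<And>p. d_gen p (iso_class F) = (\<Sum>i \<in> {i. i < length (crosscuts G) \<and> active (crosscuts G ! i)}.
       frag_cmul ((-1) ^ num_before p G i) (frag_of (iso_class (surgery G \<psi> i))))"
    using d_gen_representative[OF mem_iso_class_self \<phi>] by blast
  let ?A = "{i. i < length (crosscuts G) \<and> active (crosscuts G ! i)}"
  \<comment> \<open>On the left the sign is taken after the surgery, on the right before it;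
    inserting \<open>i\<close> into the inactive set accounts for the difference.\<close>
  have sgn: "(-1) ^ num_before id G i * sign_on \<sigma> (inactive (surgery G \<psi> i)) =
      sign_on \<sigma> (inactive F) * (-1) ^ num_before \<sigma> G i" if "i \<in> ?A" for i
  proof -
    have "i \<notin> inactive G" using that by (simp add: inactive_def)
    \<comment> \<open>This factor enters once from the differential and once from
      \<open>sign_on_insert\<close>.\<close>
    moreover have "(-1 :: int) ^ num_before id G i * (-1) ^ num_before id G i = 1"
      by (simp flip: power_mult_distrib)
    ultimately show ?thesis
      using that assms(1) sign_on_insert[of \<sigma> "inactive G" i] inactive_iso_class[OF G]
      by (simp add: inactive_surgery num_before_eq mult.left_commute)
  qed
  have "reorder \<sigma> (d_gen id (iso_class F)) = (\<Sum>i\<in>?A.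
      reorder \<sigma> (frag_cmul ((-1) ^ num_before id G i) (frag_of (iso_class (surgery G \<psi> i)))))"
    unfolding dG reorder_def by (simp add: frag_extend_sum o_def)
  also have "\<dots> = (\<Sum>i\<in>?A. frag_cmul (sign_on \<sigma> (inactive F))
      (frag_cmul ((-1) ^ num_before \<sigma> G i) (frag_of (iso_class (surgery G \<psi> i)))))"
    by (rule sum.cong) (simp_all only: reorder_cmul reorder_iso_class frag_cmul_cmul sgn)
  also have "\<dots> = frag_cmul (sign_on \<sigma> (inactive F)) (d_gen \<sigma> (iso_class F))"
    by (simp add: dG frag_cmul_sum)
  finally show ?thesis
    by (simp add: reorder_iso_class d_def frag_extend_cmul)
qed

text \<open>Linear extension of \<open>reorder_d_gen\<close>. Membership in the carrier ensures that
  every basis element of \<open>x\<close> is the class of a surface with an adapted model.\<close>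

lemma reorder_d:
  assumes "inj \<sigma>" "x \<in> carrier (chain_module L k i j b)"
  shows "reorder \<sigma> (d id x) = d \<sigma> (reorder \<sigma> x)"
proof -
  have "Poly_Mapping.keys x \<subseteq> iso_class ` gens L k i j b"
    using assms(2) by (simp add: chain_module_def carrier_free_Abelian_group_iff)
  then show ?thesis
  proof (induction x rule: frag_induction)
    case zero
    then show ?case by (simp add: d_def reorder_def)
  next
    case (one X)
    then obtain F where F: "F \<in> gens L k i j b" "X = iso_class F"
      by blast
    then show ?case
      using reorder_d_gen[OF assms(1) F(1)] by (simp add: d_def del: id_apply)
  next
    case (diff x y)
    then show ?case by (simp add: d_def reorder_def frag_extend_diff)
  qed
qed

section \<open>Bar-Natan relations and the submodule they generate\<close>

lemma reorder_chain_module: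
  "x \<in> carrier (chain_module L k i j b) \<Longrightarrow> reorder \<sigma> x \<in> carrier (chain_module L k i j b)"
  using keys_reorder by (fastforce simp: chain_module_def)

lemma BN_rels_subset: "BN_rels L k i j b \<subseteq> carrier (chain_module L k i j b)"
proof
  fix x assume "x \<in> BN_rels L k i j b"
  moreover have "frag_of (iso_class F) \<in> carrier (chain_module L k i j b)"
    if "F \<in> gens L k i j b" for F
    using that by (simp add: chain_module_def)
  moreover have "y - z \<in> carrier (chain_module L k i j b)" "y + z \<in> carrier (chain_module L k i j b)"
    if "y \<in> carrier (chain_module L k i j b)" "z \<in> carrier (chain_module L k i j b)" for y z
    using that keys_diff[of y z] keys_add[of y z] by (auto simp: chain_module_def)
  ultimately show "x \<in> carrier (chain_module L k i j b)"
    by cases auto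
qed

text \<open>Deleting a sphere or compressing alters only \<open>surf\<close> and
  \<open>dots\<close>, so \<open>inactive\<close> agrees on all terms and one sign factors out of
  the relator.\<close>

lemma reorder_BN_rels:
  assumes "x \<in> BN_rels L k i j b"
  shows "reorder \<sigma> x = x \<or> reorder \<sigma> x = - x"
proof -
  have sign: "sign_on \<sigma> A = 1 \<or> sign_on \<sigma> A = - 1" for A
    by (auto simp: sign_on_def minus_one_power_iff)
  have "\<exists>A. reorder \<sigma> x = frag_cmul (sign_on \<sigma> A) x"
    using assms
  proof cases
    case (S0 F A)
    then show ?thesis using reorder_iso_class by blast
  next
    case (S1 F A)
    have "inactive (F\<lparr>surf := surf F - A\<rparr>) = inactive F"
      by (simp add: inactive_def)
    then have "reorder \<sigma> x = frag_cmul (sign_on \<sigma> (inactive F)) x"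
      using reorder_iso_class[of \<sigma> F] reorder_iso_class[of \<sigma> "F\<lparr>surf := surf F - A\<rparr>"]
      by (simp add: S1(1) reorder_def frag_extend_diff frag_cmul_diff)
    then show ?thesis ..
  next
    case (NC F \<beta> n F1 F2)
    have "inactive F1 = inactive F" "inactive F2 = inactive F"
      by (simp_all add: inactive_def NC compress_def)
    then have "reorder \<sigma> x = frag_cmul (sign_on \<sigma> (inactive F)) x"
      using reorder_iso_class[of \<sigma> F] reorder_iso_class[of \<sigma> F1] reorder_iso_class[of \<sigma> F2]
      by (simp add: NC(1) reorder_def frag_extend_diff frag_extend_add frag_cmul_diff
          frag_cmul_distrib2)
    then show ?thesis ..
  next
    case (D2 F C)
    then show ?thesis using reorder_iso_class by blast
  qed
  then show ?thesis
    using sign by (metis frag_cmul_one frag_cmul_minus_one)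
qed

lemma comm_group_chain_module: "comm_group (chain_module L k i j b)"
  by (simp add: chain_module_def abelian_free_Abelian_group)

lemma mult_chain_module [simp]: "x \<otimes>\<^bsub>chain_module L k i j b\<^esub> y = x + y"
  by (simp add: chain_module_def)

lemma subgroup_BN_sub: "subgroup (BN_sub L k i j b) (chain_module L k i j b)"
  unfolding BN_sub_def
  by (intro group.generate_is_subgroup BN_rels_subset comm_group.axioms comm_group_chain_module)

lemma normal_BN_sub: "BN_sub L k i j b \<lhd> chain_module L k i j b"
  by (intro comm_group.subgroup_imp_normal comm_group_chain_module subgroup_BN_sub)

lemma reorder_BN_sub:
  assumes "x \<in> BN_sub L k i j b"
  shows "reorder \<sigma> x \<in> BN_sub L k i j b"
proof -
  let ?G = "chain_module L k i j b"
  have minus: "inv\<^bsub>?G\<^esub> h = - h" if "h \<in> BN_rels L k i j b" for h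
    using that BN_rels_subset by (fastforce simp: chain_module_def)
  \<comment> \<open>Both signs are recorded because \<open>generate\<close> also has a case for
    inverses of generators.\<close>
  have rel: "reorder \<sigma> h \<in> BN_sub L k i j b \<and> - reorder \<sigma> h \<in> BN_sub L k i j b"
    if "h \<in> BN_rels L k i j b" for h
    using reorder_BN_rels[OF that, of \<sigma>] generate.incl[OF that, of ?G] generate.inv[OF that, of ?G]
    by (auto simp: BN_sub_def minus[OF that])
  show ?thesis
    using assms unfolding BN_sub_def
  proof (induction rule: generate.induct)
    case one
    then show ?case
      using generate.one[of ?G "BN_rels L k i j b"] by (simp add: chain_module_def reorder_def)
  next
    case (incl h)
    then show ?case using rel by (simp add: BN_sub_def)
  next
    case (inv h)
    then show ?case using rel by (simp add: minus reorder_minus BN_sub_def)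
  next
    case (eng h1 h2)
    then show ?case
      using generate.eng[of _ ?G "BN_rels L k i j b"] by (fastforce simp: reorder_add)
  qed
qed

text \<open>The reverse inclusion holds because \<open>reorder \<sigma>\<close> is its own
  inverse.\<close>

lemma reorder_image_BN_sub: "reorder \<sigma> ` BN_sub L k i j b = BN_sub L k i j b"
proof
  show "BN_sub L k i j b \<subseteq> reorder \<sigma> ` BN_sub L k i j b"
    using reorder_BN_sub reorder_reorder by (metis image_eqI subsetI)
qed (use reorder_BN_sub in blast)

section \<open>Passage to the quotient\<close>

text \<open>Elements of \<open>BN\<close> are cosets, so direct image is the induced map on the
  quotient.\<close>

lemma reorder_image_coset:
  "reorder \<sigma> ` (BN_sub L k i j b #>\<^bsub>chain_module L k i j b\<^esub> x) =
     BN_sub L k i j b #>\<^bsub>chain_module L k i j b\<^esub> reorder \<sigma> x"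
proof -
  have "reorder \<sigma> ` (BN_sub L k i j b #>\<^bsub>chain_module L k i j b\<^esub> x) =
      (\<Union>h\<in>reorder \<sigma> ` BN_sub L k i j b. {h + reorder \<sigma> x})"
    by (simp add: r_coset_def reorder_add image_UN)
  then show ?thesis
    by (simp add: reorder_image_BN_sub r_coset_def)
qed

lemma reorder_iso_BN: "(`) (reorder \<sigma>) \<in> iso (BN L k i j b) (BN L k i j b)"
proof -
  let ?G = "chain_module L k i j b" and ?N = "BN_sub L k i j b"
  have maps: "(`) (reorder \<sigma>) ` carrier (BN L k i j b) \<subseteq> carrier (BN L k i j b)"
    using reorder_chain_module by (fastforce simp: BN_def FactGroup_def RCOSETS_def reorder_image_coset)
  have "reorder \<sigma> ` (X <#>\<^bsub>?G\<^esub> Y) = reorder \<sigma> ` X <#>\<^bsub>?G\<^esub> reorder \<sigma> ` Y" for X Y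
    by (force simp: set_mult_def reorder_add)
  with maps have "(`) (reorder \<sigma>) \<in> hom (BN L k i j b) (BN L k i j b)"
    by (auto simp: hom_def BN_def FactGroup_def)
  \<comment> \<open>The involution passes to direct images, so the induced map is its own
    inverse.\<close>
  moreover have "bij_betw ((`) (reorder \<sigma>)) (carrier (BN L k i j b)) (carrier (BN L k i j b))"
    by (rule bij_betw_byWitness[where f' = "(`) (reorder \<sigma>)"]) (use maps in \<open>auto simp: image_image\<close>)
  ultimately show ?thesis by (simp add: iso_def)
qed

text \<open>Direct image commutes with the union defining \<open>BN_d\<close>, so the claim reduces
  to \<open>reorder_d\<close> for each element of the coset \<open>X\<close>.\<close>

lemma reorder_BN_d:
  assumes "inj \<sigma>" "X \<in> carrier (BN L k i j b)"
  shows "reorder \<sigma> ` BN_d id L k i j b X = BN_d \<sigma> L k i j b (reorder \<sigma> ` X)"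
proof -
  have "X \<subseteq> carrier (chain_module L k i j b)"
    using assms(2) subgroup.rcosets_carrier[OF subgroup_BN_sub
        comm_group.axioms(2)[OF comm_group_chain_module]]
    by (simp add: BN_def FactGroup_def)
  then have "reorder \<sigma> (d id x) = d \<sigma> (reorder \<sigma> x)" if "x \<in> X" for x
    using that reorder_d[OF assms(1)] by blast
  then show ?thesis
    by (simp add: BN_d_def image_UN reorder_image_coset)
qed

theorem theorem6p1:
  fixes L :: "R4 set" and k :: nat and \<sigma> :: "nat \<Rightarrow> nat"
  assumes "link L" and "\<sigma> permutes {..<k}"
  shows "\<exists>\<psi>. chain_isomorphism (BN L k) (BN_d id L k) (BN L k) (BN_d \<sigma> L k) \<psi>"
proof -
  have "inj \<sigma>"
    using assms(2) by (rule permutes_inj)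
  \<comment> \<open>Both complexes have the same groups and differ only in their differentials, so
    in every degree the isomorphism is the self-map induced by
    \<open>reorder \<sigma>\<close>.\<close>
  then show ?thesis
    unfolding chain_isomorphism_def
    by (intro exI[of _ "\<lambda>i j b. (`) (reorder \<sigma>)"]) (auto simp: reorder_iso_BN reorder_BN_d)
qed

end
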